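(* Let $q$ be a unimodular complex number, let $V_1$ and $V_2$ be isometric operators on a Hilbert space $\mathcal H$ such that $V=V_1V_2$ is a shift operator, and let $\mathfrak r_q$ and $\mathfrak r_{\overline q}$ be the unitaries on $\mathcal H$ associated with $(V_1,V_2)$. Then: (1) $(V_1,V_2)$ is commutative if and only if $(V_1\mathfrak r_q,\mathfrak r_{\overline q} V_2)$ is $q$-commutative; (2) $(V_1,V_2)$ is $q$-commutative if and only if $(V_1\mathfrak r_{\overline q},\mathfrak r_{q} V_2)$ is commutative.
   Context: A pair $(A,B)$ of operators is $q$-commutative if $AB=qBA$, and commutative if $AB=BA$. A shift operator is an isometry $S$ with $S^{*n}\to0$ in the strong operator topology. For a contraction $T$, $D_{T^*}=(I-TT^* )^{1/2}$ and $\mathcal D_{T^*}=\overline{\operatorname{Ran}}\,D_{T^*}$. $H^2$ is the Hardy space of the unit disk and, for unimodular $q$, $R_q$ is the unitary $f(z)\mapsto f(qz)$ on $H^2$, acting in the same way on vector-valued $H^2(\mathcal F)=H^2\otimes\mathcal F$ (i.e. as $R_q\otimes I_{\mathcal F}$). For isometries $V_1,V_2$ on $\mathcal H$ with $V=V_1V_2$ a shift, put $\mathcal F=\mathcal D_{V_1^*}\oplus\mathcal D_{V_2^*}$ and let $\tau_{\rm BCL}:\mathcal H\to H^2(\mathcal F)$ be the unitary $$\tau_{\rm BCL}h=\sum_{n\ge0}z^n\left(D_{V_1^*}V^{*n}h\oplus D_{V_2^*}V_1^*V^{*n}h\right).$$ The unitary $\mathfrak r_q$ is defined by $\mathfrak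 r_q:=\tau_{\rm BCL}^*R_q\tau_{\rm BCL}:\mathcal H\to\mathcal H$, and $\mathfrak r_{\overline q}:=\tau_{\rm BCL}^*R_{\overline q}\tau_{\rm BCL}$; explicitly, $\mathfrak r_qh=\sum_{n\ge0}q^nV^nD_{V^*}V^{*n}h$. *)

theory Defs
  imports "HOL-Analysis.Analysis"
begin

section \<open>Complex Hilbert spaces\<close>

text \<open>The inner product is linear in the first argument. Positivity and definiteness
  of the inner product are contained in the axiom \<open>cinner_self\<close>.\<close>

class complex_hilbert_space = banach +
  fixes scaleC :: "complex \<Rightarrow> 'a \<Rightarrow> 'a" (infixr "*\<^sub>C" 75)
    and cinner :: "'a \<Rightarrow> 'a \<Rightarrow> complex"
  assumes scaleC_add_right: "c *\<^sub>C (x + y) = c *\<^sub>C x + c *\<^sub>C y"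
    and scaleC_add_left: "(c + d) *\<^sub>C x = c *\<^sub>C x + d *\<^sub>C x"
    and scaleC_scaleC: "c *\<^sub>C d *\<^sub>C x = (c * d) *\<^sub>C x"
    and scaleC_of_real: "complex_of_real r *\<^sub>C x = r *\<^sub>R x"
    and cinner_commute: "cinner x y = cnj (cinner y x)"
    and cinner_add_left: "cinner (x + y) z = cinner x z + cinner y z"
    and cinner_scaleC_left: "cinner (c *\<^sub>C x) y = c * cinner x y"
    and cinner_self: "cinner x x = complex_of_real ((norm x)\<^sup>2)"

instantiation complex :: complex_hilbert_space
begin

definition scaleC_complex :: "complex \<Rightarrow> complex \<Rightarrow> complex" where
  "scaleC_complex c x = c * x"

definition cinner_complex :: "complex \<Rightarrow> complex \<Rightarrow> complex" where
  "cinner_complex x y = x * cnj y"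

instance
  by standard
    (simp_all add: scaleC_complex_def cinner_complex_def algebra_simps scaleR_conv_of_real
      complex_norm_square[symmetric])

end

text \<open>The product type, with its library norm, is the Hilbert space direct sum.\<close>

instantiation prod :: (complex_hilbert_space, complex_hilbert_space) complex_hilbert_space
begin

definition scaleC_prod :: "complex \<Rightarrow> 'a \<times> 'b \<Rightarrow> 'a \<times> 'b" where
  "scaleC_prod c x = (c *\<^sub>C fst x, c *\<^sub>C snd x)"

definition cinner_prod :: "'a \<times> 'b \<Rightarrow> 'a \<times> 'b \<Rightarrow> complex" where
  "cinner_prod x y = cinner (fst x) (fst y) + cinner (snd x) (snd y)"

instance
proof
  fix x y :: "'a \<times> 'b"
  show "cinner x y = cnj (cinner y x)"
    unfolding cinner_prod_def complex_cnj_add by (metis cinner_commute)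
qed (simp_all add: scaleC_prod_def cinner_prod_def scaleC_add_right scaleC_add_left
    scaleC_scaleC scaleC_of_real cinner_add_left cinner_scaleC_left cinner_self
    norm_prod_def distrib_left scaleR_prod_def)

end


section \<open>Operators\<close>

definition bounded_clinear ::
    "('a::complex_hilbert_space \<Rightarrow> 'b::complex_hilbert_space) \<Rightarrow> bool" where
  "bounded_clinear T \<longleftrightarrow> bounded_linear T \<and> (\<forall>c x. T (c *\<^sub>C x) = c *\<^sub>C T x)"

definition cadjoint ::
    "('a::complex_hilbert_space \<Rightarrow> 'b::complex_hilbert_space) \<Rightarrow> 'b \<Rightarrow> 'a" where
  "cadjoint T = (THE S. bounded_clinear S \<and> (\<forall>x y. cinner (T x) y = cinner x (S y)))"

definition positive_operator :: "('a::complex_hilbert_space \<Rightarrow> 'a) \<Rightarrow> bool" where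
  "positive_operator T \<longleftrightarrow> bounded_clinear T \<and> (\<forall>x. cinner (T x) x \<in> \<real>\<^sub>\<ge>\<^sub>0)"

definition sqrt_operator :: "('a::complex_hilbert_space \<Rightarrow> 'a) \<Rightarrow> 'a \<Rightarrow> 'a" where
  "sqrt_operator T = (THE S. positive_operator S \<and> S \<circ> S = T)"

definition isometric_operator ::
    "('a::complex_hilbert_space \<Rightarrow> 'b::complex_hilbert_space) \<Rightarrow> bool" where
  "isometric_operator T \<longleftrightarrow> bounded_clinear T \<and> (\<forall>x. norm (T x) = norm x)"

definition shift_operator :: "('a::complex_hilbert_space \<Rightarrow> 'a) \<Rightarrow> bool" where
  "shift_operator S \<longleftrightarrow> isometric_operator S \<and> (\<forall>x. (\<lambda>n. (cadjoint S ^^ n) x) \<longlonglongrightarrow> 0)"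

definition commutative_pair ::
    "('a::complex_hilbert_space \<Rightarrow> 'a) \<Rightarrow> ('a \<Rightarrow> 'a) \<Rightarrow> bool" where
  "commutative_pair A B \<longleftrightarrow> A \<circ> B = B \<circ> A"

definition q_commutative_pair ::
    "complex \<Rightarrow> ('a::complex_hilbert_space \<Rightarrow> 'a) \<Rightarrow> ('a \<Rightarrow> 'a) \<Rightarrow> bool" where
  "q_commutative_pair q A B \<longleftrightarrow> A \<circ> B = (\<lambda>x. q *\<^sub>C (B \<circ> A) x)"

text \<open>\<open>codefect T\<close> is the defect operator of the adjoint of \<open>T\<close>, written
  \<open>D\<close> with subscript \<open>T\<^sup>*\<close>, and \<open>codefect_space T\<close> is the associated defect space.\<close>

definition codefect :: "('a::complex_hilbert_space \<Rightarrow> 'a) \<Rightarrow> 'a \<Rightarrow> 'a" where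
  "codefect T = sqrt_operator (\<lambda>x. x - T (cadjoint T x))"

definition codefect_space :: "('a::complex_hilbert_space \<Rightarrow> 'a) \<Rightarrow> 'a set" where
  "codefect_space T = closure (range (codefect T))"


section \<open>Vector-valued Hardy spaces on the unit disk\<close>

text \<open>Elements are functions on the open unit disk, extended by \<open>0\<close> to the whole plane.
  \<open>hardy_fun c\<close> is the function with Taylor coefficients \<open>c\<close>; \<open>hardy_space F\<close> is meant
  for closed subspaces \<open>F\<close>.\<close>

definition hardy_fun :: "(nat \<Rightarrow> 'b::complex_hilbert_space) \<Rightarrow> complex \<Rightarrow> 'b" where
  "hardy_fun c = (\<lambda>z. if cmod z < 1 then \<Sum>n. z ^ n *\<^sub>C c n else 0)"

definition hardy_space :: "'b::complex_hilbert_space set \<Rightarrow> (complex \<Rightarrow> 'b) set" where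
  "hardy_space F = {hardy_fun c | c. range c \<subseteq> F \<and> summable (\<lambda>n. (norm (c n))\<^sup>2)}"

definition hardy_coeff :: "(complex \<Rightarrow> 'b::complex_hilbert_space) \<Rightarrow> nat \<Rightarrow> 'b" where
  "hardy_coeff f = (THE c. \<forall>z. cmod z < 1 \<longrightarrow> (\<lambda>n. z ^ n *\<^sub>C c n) sums f z)"

definition hardy_inner ::
    "(complex \<Rightarrow> 'b::complex_hilbert_space) \<Rightarrow> (complex \<Rightarrow> 'b) \<Rightarrow> complex" where
  "hardy_inner f g = (\<Sum>n. cinner (hardy_coeff f n) (hardy_coeff g n))"

definition hardy_rotation ::
    "complex \<Rightarrow> (complex \<Rightarrow> 'b::complex_hilbert_space) \<Rightarrow> complex \<Rightarrow> 'b" where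
  "hardy_rotation q f = (\<lambda>z. f (q * z))"

text \<open>Adjoint of an operator \<open>T\<close> from a Hilbert space into \<open>hardy_space F\<close>.\<close>

definition hardy_adjoint ::
    "'b::complex_hilbert_space set \<Rightarrow> ('a::complex_hilbert_space \<Rightarrow> complex \<Rightarrow> 'b)
      \<Rightarrow> (complex \<Rightarrow> 'b) \<Rightarrow> 'a" where
  "hardy_adjoint F T =
    (\<lambda>f\<in>hardy_space F. THE h. \<forall>x. hardy_inner (T x) f = cinner x h)"


section \<open>The Berger--Coburn--Lebow transform and the associated unitaries\<close>

definition bcl_space :: "('a::complex_hilbert_space \<Rightarrow> 'a) \<Rightarrow> ('a \<Rightarrow> 'a) \<Rightarrow> ('a \<times> 'a) set" where
  "bcl_space V1 V2 = codefect_space V1 \<times> codefect_space V2"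

definition bcl_transform ::
    "('a::complex_hilbert_space \<Rightarrow> 'a) \<Rightarrow> ('a \<Rightarrow> 'a) \<Rightarrow> 'a \<Rightarrow> complex \<Rightarrow> 'a \<times> 'a" where
  "bcl_transform V1 V2 h = hardy_fun (\<lambda>n.
     (codefect V1 ((cadjoint (V1 \<circ> V2) ^^ n) h),
      codefect V2 (cadjoint V1 ((cadjoint (V1 \<circ> V2) ^^ n) h))))"

definition bcl_rotation ::
    "('a::complex_hilbert_space \<Rightarrow> 'a) \<Rightarrow> ('a \<Rightarrow> 'a) \<Rightarrow> complex \<Rightarrow> 'a \<Rightarrow> 'a" where
  "bcl_rotation V1 V2 q =
     hardy_adjoint (bcl_space V1 V2) (bcl_transform V1 V2)
       \<circ> hardy_rotation q \<circ> bcl_transform V1 V2"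

end

(*
  With V = V1 V2 and the mutually orthogonal Wold projections E_n = V^n (I - V V^* ) V^{*n}, the
  Taylor coefficients c_n of the BCL transform satisfy <c_n(x), c_n(y)> = <x, E_n y>, because
  V^* = V2^* V1^* makes the two codefects telescope.  Hence the rotation r_q is the strongly
  convergent series of the q^n E_n.  Since E_0 V = 0 and E_{n+1} V = V E_n, it satisfies
  r_q V = q V r_q, and V being a shift gives that r_q is inverse to its conjugate r_{cnj q}.
  Both equivalences are then algebra with these two relations.
*)

theory Submission
  imports Defs
begin

section \<open>Inner product and adjoint\<close>

lemma cinner_add_right: "cinner x (y + z) = cinner x y + cinner x z"
  by (metis cinner_commute cinner_add_left complex_cnj_add)

lemma cinner_scaleC_right: "cinner x (c *\<^sub>C y) = cnj c * cinner x y"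
  by (metis cinner_commute cinner_scaleC_left complex_cnj_mult)

lemma scaleC_one [simp]: "1 *\<^sub>C x = x"
  using scaleC_of_real[of 1 x] by simp

lemma scaleC_zero_right [simp]: "c *\<^sub>C 0 = 0"
  using scaleC_add_right[of c 0 0] by simp

lemma scaleC_diff_right: "c *\<^sub>C (x - y) = c *\<^sub>C x - c *\<^sub>C y"
  using scaleC_add_right[of c "x - y" y] by simp

lemma cinner_zero_left [simp]: "cinner 0 y = 0"
  using cinner_add_left[of 0 0 y] by simp

lemma cinner_zero_right [simp]: "cinner x 0 = 0"
  using cinner_add_right[of x 0 0] by simp

lemma cinner_diff_left: "cinner (x - y) z = cinner x z - cinner y z"
  using cinner_add_left[of "x - y" y z] by simp

lemma cinner_diff_right: "cinner x (y - z) = cinner x y - cinner x z"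
  using cinner_add_right[of x "y - z" z] by simp

lemma cinner_scaleR_left: "cinner (r *\<^sub>R x) y = of_real r * cinner x y"
  by (metis cinner_scaleC_left scaleC_of_real)

lemma cinner_scaleR_right: "cinner x (r *\<^sub>R y) = of_real r * cinner x y"
  using cinner_scaleC_right[of x "of_real r" y] by (simp add: scaleC_of_real)

lemma cinner_self_eq_0 [simp]: "cinner x x = 0 \<longleftrightarrow> x = 0"
  by (simp add: cinner_self)

lemma cinner_ext_right:
  assumes "\<And>x. cinner x y = cinner x z"
  shows "y = z"
  using assms[of "y - z"] cinner_self_eq_0[of "y - z"] by (simp add: cinner_diff_right)

lemma norm_scaleC: "norm (c *\<^sub>C x) = cmod c * norm x"
proof -
  have "complex_of_real ((norm (c *\<^sub>C x))\<^sup>2) = (c * cnj c) * cinner x x"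
    by (simp only: cinner_self[symmetric] cinner_scaleC_left cinner_scaleC_right mult_ac)
  also have "\<dots> = complex_of_real ((cmod c * norm x)\<^sup>2)"
    by (simp only: cinner_self power_mult_distrib complex_norm_square[symmetric] of_real_mult)
  finally have "(norm (c *\<^sub>C x))\<^sup>2 = (cmod c * norm x)\<^sup>2"
    by (simp only: of_real_eq_iff)
  then show ?thesis
    by (rule power2_eq_imp_eq) simp_all
qed

lemma norm_add_square:
  fixes x y :: "'a::complex_hilbert_space"
  shows "(norm (x + y))\<^sup>2 = (norm x)\<^sup>2 + (norm y)\<^sup>2 + 2 * Re (cinner x y)"
proof -
  have "(norm z)\<^sup>2 = Re (cinner z z)" for z :: 'a
    by (simp add: cinner_self)
  moreover have "Re (cinner y x) = Re (cinner x y)"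
    by (metis cinner_commute complex_cnj(1) complex.sel(1) cnj.sel(1))
  ultimately show ?thesis
    by (simp add: cinner_add_left cinner_add_right)
qed

text \<open>The norm already satisfies the triangle inequality; squaring it and cancelling leaves
  this bound.\<close>

lemma Re_cinner_le: "Re (cinner x y) \<le> norm x * norm y"
proof -
  have "(norm (x + y))\<^sup>2 \<le> (norm x + norm y)\<^sup>2"
    by (simp add: norm_triangle_ineq power_mono)
  then show ?thesis
    unfolding norm_add_square by (simp add: power2_sum)
qed

lemma cauchy_schwarz: "cmod (cinner x y) \<le> norm x * norm y"
proof (cases "cinner x y = 0")
  case False
  \<comment> \<open>Multiplying \<open>x\<close> by this phase makes the inner product real and
    nonnegative, so the bound on real parts applies.\<close>
  define c where "c = cnj (sgn (cinner x y))"
  have c: "cmod c = 1"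
    using False by (simp add: c_def norm_sgn)
  have "c * cinner x y = of_real (cmod (cinner x y))"
    using False by (simp add: c_def sgn_eq complex_norm_square[symmetric] power2_eq_square
        mult.commute[of "cnj _"])
  then have "cmod (cinner x y) = Re (cinner (c *\<^sub>C x) y)"
    by (simp add: cinner_scaleC_left)
  also have "\<dots> \<le> norm x * norm y"
    using Re_cinner_le[of "c *\<^sub>C x" y] by (simp add: norm_scaleC c)
  finally show ?thesis .
qed simp

lemma bounded_linear_cinner_left: "bounded_linear (\<lambda>x. cinner x y)"
  by (rule bounded_linear_intro[where K = "norm y"])
    (simp_all add: cinner_add_left cinner_scaleR_left scaleR_conv_of_real cauchy_schwarz)

lemma bounded_linear_cinner_right: "bounded_linear (cinner x)"
  by (rule bounded_linear_intro[where K = "norm x"])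
    (use cauchy_schwarz[of x] in
      \<open>simp_all add: cinner_add_right cinner_scaleR_right scaleR_conv_of_real mult.commute\<close>)

lemma bounded_linear_scaleC: "bounded_linear (\<lambda>x. c *\<^sub>C x)"
proof (rule bounded_linear_intro[where K = "cmod c"])
  show "c *\<^sub>C r *\<^sub>R x = r *\<^sub>R c *\<^sub>C x" for r x
    by (simp flip: scaleC_of_real add: scaleC_scaleC mult.commute)
qed (simp_all add: scaleC_add_right norm_scaleC)

text \<open>The representing vector minimises the functional \<open>\<parallel>x\<parallel>\<^sup>2 - 2 \<phi> x\<close>.\<close>

lemma riesz_representation_real:
  fixes \<phi> :: "'a::complex_hilbert_space \<Rightarrow> real"
  assumes "bounded_linear \<phi>"
  shows "\<exists>u. \<forall>x. \<phi> x = Re (cinner x u)"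
proof -
  interpret bounded_linear \<phi> by fact
  define J where "J x = (norm x)\<^sup>2 - 2 * \<phi> x" for x
  define m where "m = Inf (range J)"
  obtain K where K: "\<And>x. norm (\<phi> x) \<le> norm x * K"
    using bounded by blast
  have "J x \<ge> - K\<^sup>2" for x
  proof -
    have "\<phi> x \<le> norm x * K"
      using K[of x] by simp
    moreover have "0 \<le> (norm x - K)\<^sup>2"
      by simp
    ultimately show ?thesis
      unfolding J_def power2_diff by linarith
  qed
  then have bdd: "bdd_below (range J)"
    by (intro bdd_belowI2)
  have m_le: "m \<le> J x" for x
    unfolding m_def by (rule cInf_lower[OF _ bdd]) simp
  have "\<exists>x. J x < m + 1 / real (Suc n)" for n
    using cInf_lessD[of "range J" "m + 1 / real (Suc n)"] by (auto simp: m_def)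
  then obtain X where X: "\<And>n. J (X n) < m + 1 / real (Suc n)"
    by metis
  \<comment> \<open>Parallelogram law; the linear part of \<open>J\<close> cancels. As
    \<open>J\<close> is at least \<open>m\<close> at midpoints, minimising sequences are
    Cauchy.\<close>
  have midpoint: "(norm (x - y))\<^sup>2 = 2 * J x + 2 * J y - 4 * J ((1/2) *\<^sub>R (x + y))" for x y
  proof -
    have "(norm ((1/2) *\<^sub>R (x + y)))\<^sup>2 = (norm (x + y))\<^sup>2 / 4"
      by (simp add: power_divide del: scaleR_add_right)
    moreover have "\<phi> ((1/2) *\<^sub>R (x + y)) = (\<phi> x + \<phi> y) / 2"
      by (simp only: add scale real_scaleR_def)
    ultimately show ?thesis
      using norm_add_square[of x y] norm_add_square[of x "- y"] cinner_diff_right[of x 0 y]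
      by (simp add: J_def)
  qed
  have "Cauchy X"
  proof (rule metric_CauchyI)
    fix e :: real
    assume e: "0 < e"
    obtain N where N: "4 / e\<^sup>2 < real N"
      using reals_Archimedean2 by blast
    have "dist (X i) (X j) < e" if "i \<ge> N" "j \<ge> N" for i j
    proof -
      have "J (X k) \<le> m + 1 / real (Suc N)" if "k \<ge> N" for k
        using X[of k] frac_le[of 1 1 "real (Suc N)" "real (Suc k)"] that by simp
      from this[OF that(1)] this[OF that(2)]
      have "(norm (X i - X j))\<^sup>2 \<le> 4 / real (Suc N)"
        using midpoint[of "X i" "X j"] m_le[of "(1/2) *\<^sub>R (X i + X j)"] by simp
      also have "\<dots> < e\<^sup>2"
        using N e by (simp add: field_simps add_pos_pos less_add_same_cancel2)
          (smt (verit) zero_less_power)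
      finally show ?thesis
        using e by (simp add: dist_norm power2_less_imp_less)
    qed
    then show "\<exists>M. \<forall>i\<ge>M. \<forall>j\<ge>M. dist (X i) (X j) < e"
      by blast
  qed
  then obtain u where u: "X \<longlonglongrightarrow> u"
    using Cauchy_convergent_iff convergent_def by blast
  have "(\<lambda>n. J (X n)) \<longlonglongrightarrow> J u"
    unfolding J_def by (intro tendsto_intros u tendsto[OF u])
  moreover have "(\<lambda>n. m + 1 / real (Suc n)) \<longlonglongrightarrow> m + 0"
    by (intro tendsto_intros LIMSEQ_Suc[OF lim_1_over_n])
  ultimately have Ju: "J u \<le> m"
    using X by (auto intro: LIMSEQ_le less_imp_le)
  have "\<phi> y = Re (cinner y u)" for y
  proof -
    \<comment> \<open>First variation of \<open>J\<close> at the minimiser: \<open>t\<close> makes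
      the quadratic bound equal to \<open>- (a^2 / s)\<close>, which forces \<open>a = 0\<close>.
      The summand 1 keeps \<open>s\<close> positive even when \<open>y = 0\<close>.\<close>
    define a where "a = Re (cinner y u) - \<phi> y"
    define s where "s = (norm y)\<^sup>2 + 1"
    define t where "t = - a / s"
    have s: "s > 0"
      by (simp add: s_def add_nonneg_pos)
    have "0 \<le> J (t *\<^sub>R y + u) - J u"
      using Ju m_le[of "t *\<^sub>R y + u"] by simp
    also have "\<dots> = t\<^sup>2 * (norm y)\<^sup>2 + 2 * t * a"
      unfolding J_def norm_add_square
      by (simp add: add scale cinner_scaleR_left power_mult_distrib a_def algebra_simps)
    also have "\<dots> \<le> t\<^sup>2 * s + 2 * t * a"
      by (simp add: s_def mult_left_mono)
    also have "\<dots> = - (a\<^sup>2 / s)"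
      using s by (simp add: t_def power2_eq_square field_simps)
    finally have "a = 0"
      using s by (simp add: divide_le_0_iff)
    then show ?thesis
      by (simp add: a_def)
  qed
  then show ?thesis
    by blast
qed

text \<open>A complex-linear functional is determined by its real part: evaluating at
  \<open>\<i> *\<^sub>C x\<close> recovers the imaginary part.\<close>

lemma riesz_representation:
  fixes \<phi> :: "'a::complex_hilbert_space \<Rightarrow> complex"
  assumes "bounded_clinear \<phi>"
  shows "\<exists>u. \<forall>x. \<phi> x = cinner x u"
proof -
  have bl: "bounded_linear \<phi>" and hom: "\<And>c x. \<phi> (c *\<^sub>C x) = c * \<phi> x"
    using assms by (auto simp: bounded_clinear_def scaleC_complex_def)
  obtain u where u: "\<And>x. Re (\<phi> x) = Re (cinner x u)"
    using riesz_representation_real[OF bounded_linear_compose[OF bounded_linear_Re bl]] by auto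
  have "Im (\<phi> x) = Im (cinner x u)" for x
    using u[of "\<i> *\<^sub>C x"] by (simp add: hom cinner_scaleC_left)
  then show ?thesis
    using u by (auto simp: complex_eq_iff)
qed

section \<open>Bounded complex-linear operators and their adjoints\<close>

lemma bounded_clinearI:
  assumes "\<And>x y. T (x + y) = T x + T y"
    and "\<And>c x. T (c *\<^sub>C x) = c *\<^sub>C T x"
    and "\<And>x. norm (T x) \<le> norm x * K"
  shows "bounded_clinear T"
proof -
  have "bounded_linear T"
    using assms(1,3) assms(2)[of "of_real _"]
    by (intro bounded_linear_intro[where K = K]) (simp_all add: scaleC_of_real)
  then show ?thesis
    using assms(2) by (simp add: bounded_clinear_def)
qed

lemma bounded_clinearD:
  assumes "bounded_clinear T"
  shows "bounded_linear T" and "T (x + y) = T x + T y" and "T (x - y) = T x - T y"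
    and "T 0 = 0" and "T (c *\<^sub>C x) = c *\<^sub>C T x"
proof -
  show bl: "bounded_linear T" and "T (c *\<^sub>C x) = c *\<^sub>C T x"
    using assms by (auto simp: bounded_clinear_def)
  show "T (x + y) = T x + T y" "T (x - y) = T x - T y" "T 0 = 0"
    using bounded_linear.linear[OF bl] by (simp_all add: linear_add linear_diff linear_0)
qed

lemma bounded_clinear_compose:
  assumes "bounded_clinear S" "bounded_clinear T"
  shows "bounded_clinear (S \<circ> T)"
  using assms bounded_linear_compose[of S T] by (simp add: bounded_clinear_def comp_def)

lemma bounded_clinear_diff:
  assumes "bounded_clinear S" "bounded_clinear T"
  shows "bounded_clinear (\<lambda>x. S x - T x)"
  using assms by (simp add: bounded_clinear_def bounded_linear_sub scaleC_diff_right)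

lemma bounded_clinear_id: "bounded_clinear (\<lambda>x. x)"
  by (simp add: bounded_clinear_def)

text \<open>Riesz representation gives \<open>S y\<close> for each \<open>y\<close>; uniqueness of
  the representing vector gives linearity, and the bound comes from
  \<open>(norm (S y))^2 = cmod (cinner (T (S y)) y)\<close>. Existence is what gives meaning to the
  definite description in \<open>cadjoint\<close>.\<close>

lemma adjoint_exists:
  fixes T :: "'a::complex_hilbert_space \<Rightarrow> 'b::complex_hilbert_space"
  assumes T: "bounded_clinear T"
  shows "\<exists>S. bounded_clinear S \<and> (\<forall>x y. cinner (T x) y = cinner x (S y))"
proof -
  note lin = bounded_clinearD[OF T]
  obtain K where K: "\<And>x. norm (T x) \<le> norm x * K" and "K > 0"
    using bounded_linear.pos_bounded[OF lin(1)] by blast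
  have "bounded_clinear (\<lambda>x. cinner (T x) y)" for y
    using bounded_linear_compose[OF bounded_linear_cinner_left lin(1)]
    by (auto simp: bounded_clinear_def lin(5) cinner_scaleC_left scaleC_complex_def)
  then have "\<forall>y. \<exists>u. \<forall>x. cinner (T x) y = cinner x u"
    using riesz_representation by blast
  from choice[OF this] obtain S where S: "\<And>x y. cinner (T x) y = cinner x (S y)"
    by blast
  have "bounded_clinear S"
  proof (rule bounded_clinearI)
    show "S (y + z) = S y + S z" for y z
      by (rule cinner_ext_right) (simp add: S[symmetric] cinner_add_right)
    show "S (c *\<^sub>C y) = c *\<^sub>C S y" for c y
      by (rule cinner_ext_right) (simp add: S[symmetric] cinner_scaleC_right)
    show "norm (S y) \<le> norm y * K" for y
    proof -
      have "(norm (S y))\<^sup>2 = cmod (cinner (T (S y)) y)"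
        by (simp add: S cinner_self norm_power)
      also have "\<dots> \<le> norm (T (S y)) * norm y"
        by (rule cauchy_schwarz)
      also have "\<dots> \<le> norm (S y) * K * norm y"
        by (simp add: K mult_right_mono)
      finally have "norm (S y) * norm (S y) \<le> norm (S y) * (norm y * K)"
        by (simp add: power2_eq_square mult_ac)
      then show ?thesis
        using \<open>K > 0\<close> by (cases "S y = 0") auto
    qed
  qed
  with S show ?thesis
    by blast
qed

lemma cadjoint_eqI:
  assumes "bounded_clinear S" "\<And>x y. cinner (T x) y = cinner x (S y)"
  shows "cadjoint T = S"
  unfolding cadjoint_def
proof (rule the_equality)
  fix S' assume "bounded_clinear S' \<and> (\<forall>x y. cinner (T x) y = cinner x (S' y))"
  then show "S' = S"
    using assms(2) by (metis cinner_ext_right ext)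
qed (use assms in blast)

lemma
  assumes "bounded_clinear T"
  shows bounded_clinear_cadjoint: "bounded_clinear (cadjoint T)"
    and cinner_cadjoint: "cinner (T x) y = cinner x (cadjoint T y)"
proof -
  obtain S where S: "bounded_clinear S" "\<And>x y. cinner (T x) y = cinner x (S y)"
    using adjoint_exists[OF assms] by blast
  then have "cadjoint T = S"
    by (rule cadjoint_eqI)
  with S show "bounded_clinear (cadjoint T)" "cinner (T x) y = cinner x (cadjoint T y)"
    by simp_all
qed

lemma cinner_cadjoint_left:
  assumes "bounded_clinear T"
  shows "cinner (cadjoint T x) y = cinner x (T y)"
  by (metis assms cinner_cadjoint cinner_commute)

lemma cadjoint_comp:
  assumes "bounded_clinear S" "bounded_clinear T"
  shows "cadjoint (S \<circ> T) = cadjoint T \<circ> cadjoint S"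
proof (rule cadjoint_eqI)
  show "bounded_clinear (cadjoint T \<circ> cadjoint S)"
    by (intro bounded_clinear_compose bounded_clinear_cadjoint assms)
  show "cinner ((S \<circ> T) x) y = cinner x ((cadjoint T \<circ> cadjoint S) y)" for x y
    by (simp add: cinner_cadjoint[OF assms(1)] cinner_cadjoint[OF assms(2)])
qed

lemma cinner_cadjoint_funpow:
  fixes T :: "'a::complex_hilbert_space \<Rightarrow> 'a"
  assumes "bounded_clinear T"
  shows "cinner ((T ^^ n) x) y = cinner x ((cadjoint T ^^ n) y)"
proof (induction n arbitrary: y)
  case (Suc n)
  have "cinner ((T ^^ Suc n) x) y = cinner ((T ^^ n) x) (cadjoint T y)"
    by (simp add: cinner_cadjoint[OF assms])
  also have "\<dots> = cinner x ((cadjoint T ^^ n) (cadjoint T y))"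
    by (rule Suc.IH)
  finally show ?case
    by (simp only: funpow_Suc_right comp_apply)
qed simp

lemma bounded_clinear_funpow:
  fixes T :: "'a::complex_hilbert_space \<Rightarrow> 'a"
  assumes "bounded_clinear T"
  shows "bounded_clinear (T ^^ n)"
proof (induction n)
  case (Suc n)
  then show ?case
    unfolding funpow.simps by (rule bounded_clinear_compose[OF assms])
qed (simp add: bounded_clinear_id id_def)

section \<open>Isometries\<close>

lemma isometric_operator_funpow:
  fixes T :: "'a::complex_hilbert_space \<Rightarrow> 'a"
  assumes "isometric_operator T"
  shows "isometric_operator (T ^^ n)"
proof -
  have "norm ((T ^^ n) x) = norm x" for x
    using assms by (induction n) (simp_all add: isometric_operator_def)
  then show ?thesis
    using assms by (simp add: isometric_operator_def bounded_clinear_funpow)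
qed

text \<open>Polarisation: norms of sums determine the real part, and replacing \<open>x\<close> by
  \<open>\<i> *\<^sub>C x\<close> gives the imaginary part.\<close>

lemma cinner_isometric_operator:
  assumes "isometric_operator T"
  shows "cinner (T x) (T y) = cinner x y"
proof -
  have T: "bounded_clinear T" and n: "\<And>x. norm (T x) = norm x"
    using assms by (auto simp: isometric_operator_def)
  have Re: "Re (cinner (T x) (T y)) = Re (cinner x y)" for x y
    using norm_add_square[of x y] norm_add_square[of "T x" "T y"] n[of "x + y"]
    by (simp add: bounded_clinearD(2)[OF T] n)
  have "Im (cinner (T x) (T y)) = Im (cinner x y)"
    using Re[of "\<i> *\<^sub>C x" y] by (simp add: bounded_clinearD(5)[OF T] cinner_scaleC_left)
  then show ?thesis
    using Re by (simp add: complex_eq_iff)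
qed

lemma cadjoint_isometric_operator:
  assumes "isometric_operator T"
  shows "cadjoint T (T x) = x"
proof (rule cinner_ext_right)
  have "bounded_clinear T"
    using assms by (simp add: isometric_operator_def)
  then show "cinner y (cadjoint T (T x)) = cinner y x" for y
    by (simp add: cinner_cadjoint[symmetric] cinner_isometric_operator[OF assms])
qed


section \<open>Codefect operators of isometries\<close>

text \<open>Uniqueness of the positive square root, in the only case required. Splitting
  \<open>x\<close> as \<open>P x + (x - P x)\<close>, it suffices that \<open>S\<close> vanishes on
  the kernel of \<open>P\<close> and fixes its range.\<close>

lemma positive_sqrt_of_idempotent:
  assumes P: "bounded_clinear P" "\<And>x. P (P x) = P x"
    and S: "positive_operator S" "S \<circ> S = P"
  shows "S = P"
proof
  fix x
  have lin: "bounded_clinear S" and pos: "\<And>x. cinner (S x) x \<in> \<real>\<^sub>\<ge>\<^sub>0"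
    using S(1) by (auto simp: positive_operator_def)
  note S_lin = bounded_clinearD[OF lin]
  have SS: "S (S x) = P x" for x
    using S(2) by (metis comp_apply)
  have kernel: "S z = 0" if "P z = 0" for z
  proof (rule ccontr)
    define y where "y = S z"
    assume "S z \<noteq> 0"
    then have y: "cinner y y \<noteq> 0"
      by (simp add: y_def)
    \<comment> \<open>Since \<open>S y = P z = 0\<close>, the quadratic form of \<open>S\<close> at
      \<open>z + t *\<^sub>C y\<close> is affine in \<open>cnj t\<close>; this \<open>t\<close>
      gives it the value -1, against positivity.\<close>
    define t where "t = cnj (- (cinner y z + 1) / cinner y y)"
    have "S (z + t *\<^sub>C y) = y"
      using that by (simp add: S_lin SS y_def)
    then have "cinner (S (z + t *\<^sub>C y)) (z + t *\<^sub>C y) = cinner y z + cnj t * cinner y y"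
      by (simp add: cinner_add_right cinner_scaleC_right)
    also have "\<dots> = - 1"
      using y by (simp add: t_def)
    finally show False
      using pos[of "z + t *\<^sub>C y"] by (simp add: complex_nonneg_Reals_iff)
  qed
  have range: "S w = w" if "P w = w" for w
  proof -
    \<comment> \<open>If nonzero, this would be an eigenvector of \<open>S\<close> for the
      eigenvalue -1.\<close>
    define y where "y = S w - w"
    have "S y = - y"
      using that by (simp add: y_def S_lin SS)
    then have "cinner (S y) y = - complex_of_real ((norm y)\<^sup>2)"
      using cinner_diff_left[of 0 y y] by (simp add: cinner_self)
    with pos[of y] have "y = 0"
      by (simp add: complex_nonneg_Reals_iff)
    then show ?thesis
      by (simp add: y_def)
  qed
  have "S x = S (P x) + S (x - P x)"
    by (simp add: S_lin(2)[symmetric])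
  also have "\<dots> = P x"
    using range[of "P x"] kernel[of "x - P x"] by (simp add: P(2) bounded_clinearD(3)[OF P(1)])
  finally show "S x = P x" .
qed

text \<open>For an isometry the operator under the root is an orthogonal projection, hence its own
  positive square root.\<close>

lemma codefect_isometric_operator:
  assumes T: "isometric_operator T"
  shows "codefect T = (\<lambda>x. x - T (cadjoint T x))"
proof -
  define P where "P = (\<lambda>x. x - T (cadjoint T x))"
  have lin: "bounded_clinear T"
    using T by (simp add: isometric_operator_def)
  have P: "bounded_clinear P"
    unfolding P_def
    using bounded_clinear_diff[OF bounded_clinear_id
        bounded_clinear_compose[OF lin bounded_clinear_cadjoint[OF lin]]]
    by (simp add: comp_def)
  have idem: "P (P x) = P x" for x
    by (simp add: P_def bounded_clinearD[OF bounded_clinear_cadjoint[OF lin]]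
        cadjoint_isometric_operator[OF T] bounded_clinearD[OF lin])
  have "cinner (P x) x = cinner (P x) (P x)" for x
    by (simp add: P_def cinner_diff_left cinner_diff_right cinner_isometric_operator[OF T]
        cinner_cadjoint[OF lin] cinner_cadjoint_left[OF lin, symmetric]
        cadjoint_isometric_operator[OF T] bounded_clinearD[OF bounded_clinear_cadjoint[OF lin]])
  then have "positive_operator P"
    by (simp add: positive_operator_def P cinner_self)
  moreover have "P \<circ> P = P"
    by (auto simp: idem)
  ultimately have "sqrt_operator P = P"
    unfolding sqrt_operator_def
    by (intro the_equality conjI) (assumption | elim conjE positive_sqrt_of_idempotent[OF P idem])+
  then show ?thesis
    by (simp add: codefect_def P_def)
qed

text \<open>Written as a difference so that the codefects of \<open>V1\<close> and \<open>V2\<close>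
  telescope in the transform.\<close>

lemma cinner_codefect:
  assumes T: "isometric_operator T"
  shows "cinner (codefect T x) (codefect T y) = cinner x y - cinner (cadjoint T x) (cadjoint T y)"
proof -
  have lin: "bounded_clinear T"
    using T by (simp add: isometric_operator_def)
  show ?thesis
    by (simp add: codefect_isometric_operator[OF T] cinner_diff_left cinner_diff_right
        cinner_isometric_operator[OF T] cinner_cadjoint[OF lin]
        cinner_cadjoint_left[OF lin, symmetric]
        cadjoint_isometric_operator[OF T] bounded_clinearD[OF bounded_clinear_cadjoint[OF lin]])
qed

lemma codefect_scaleC:
  assumes T: "isometric_operator T"
  shows "codefect T (c *\<^sub>C x) = c *\<^sub>C codefect T x"
proof -
  have lin: "bounded_clinear T"
    using T by (simp add: isometric_operator_def)
  show ?thesis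
    by (simp add: codefect_isometric_operator[OF T] scaleC_diff_right bounded_clinearD[OF lin]
        bounded_clinearD[OF bounded_clinear_cadjoint[OF lin]])
qed


section \<open>Taylor coefficients of Hardy space functions\<close>

text \<open>Square summable coefficients are bounded, so inside the disk a geometric series
  dominates.\<close>

lemma hardy_fun_sums:
  fixes c :: "nat \<Rightarrow> 'b::complex_hilbert_space"
  assumes c: "summable (\<lambda>n. (norm (c n))\<^sup>2)" and z: "cmod z < 1"
  shows "(\<lambda>n. z ^ n *\<^sub>C c n) sums hardy_fun c z"
proof -
  have "Bseq (\<lambda>n. (norm (c n))\<^sup>2)"
    using summable_LIMSEQ_zero[OF c] by (intro convergent_imp_Bseq convergentI)
  then obtain K where K: "\<And>n. (norm (c n))\<^sup>2 \<le> K"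
    by (auto simp: Bseq_def)
  have "norm (c n) \<le> K + 1" for n
  proof -
    have "2 * norm (c n) \<le> (norm (c n))\<^sup>2 + 1"
      using zero_le_power2[of "norm (c n) - 1"] by (simp add: power2_diff)
    then show ?thesis
      using K[of n] zero_le_power2[of "norm (c n)"] by linarith
  qed
  then have le: "norm (z ^ n *\<^sub>C c n) \<le> cmod z ^ n * (K + 1)" for n
    by (simp add: norm_scaleC norm_power mult_left_mono)
  have "summable (\<lambda>n. cmod z ^ n * (K + 1))"
    using z by (intro summable_mult2 summable_geometric) simp
  then have "summable (\<lambda>n. z ^ n *\<^sub>C c n)"
    using le by (rule summable_comparison_test')
  then show ?thesis
    using z by (simp add: hardy_fun_def summable_sums)
qed

text \<open>Pairing the difference series with the fixed vector \<open>c m - d m\<close> reduces to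
  scalar power series; at index \<open>m\<close> the paired coefficient is the squared norm of that
  vector.\<close>

lemma power_series_coeff_unique:
  fixes c d :: "nat \<Rightarrow> 'b::complex_hilbert_space"
  assumes "\<And>z. cmod z < 1 \<Longrightarrow> (\<lambda>n. z ^ n *\<^sub>C c n) sums f z"
    and "\<And>z. cmod z < 1 \<Longrightarrow> (\<lambda>n. z ^ n *\<^sub>C d n) sums f z"
  shows "c = d"
proof
  fix m
  define y where "y = c m - d m"
  define a where "a n = cinner (c n - d n) y" for n
  have sums: "(\<lambda>n. a n * z ^ n) sums 0" if "cmod z < 1" for z
  proof -
    have "(\<lambda>n. z ^ n *\<^sub>C c n - z ^ n *\<^sub>C d n) sums (f z - f z)"
      using assms that by (intro sums_diff) auto
    from bounded_linear.sums[OF bounded_linear_cinner_left this]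
    show ?thesis
      by (simp add: a_def scaleC_diff_right[symmetric] cinner_scaleC_left mult.commute)
  qed
  have "a m = 0" for m
  proof (induction m rule: less_induct)
    case (less m)
    \<comment> \<open>Dividing out \<open>z ^ m\<close> needs \<open>z\<close> nonzero, so the
      leading coefficient is then read off as a limit at 0, not as a value there.\<close>
    have "(\<lambda>n. a (n + m) * z ^ n) sums 0" if z: "z \<noteq> 0" "cmod z < 1" for z
    proof -
      have "(\<lambda>n. a (n + m) * z ^ (n + m)) sums 0"
        using sums[OF z(2)] less.IH by (subst sums_zero_iff_shift) auto
      from sums_divide[OF this, of "z ^ m"] show ?thesis
        using z(1) by (simp add: power_add)
    qed
    then have "((\<lambda>z::complex. 0) \<longlongrightarrow> a (0 + m)) (at 0)"
      by (rule powser_limit_0_strong[OF zero_less_one])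
    then show "a m = 0"
      by (simp add: tendsto_const_iff)
  qed
  from this[of m] show "c m = d m"
    by (simp add: a_def y_def)
qed

lemma hardy_coeff_hardy_fun:
  assumes "summable (\<lambda>n. (norm (c n))\<^sup>2)"
  shows "hardy_coeff (hardy_fun c) = c"
  unfolding hardy_coeff_def
  using hardy_fun_sums[OF assms] by (intro the_equality) (auto intro: power_series_coeff_unique)

text \<open>Unimodularity makes the rotation preserve both the disk and its complement, in agreement
  with the extension by 0.\<close>

lemma hardy_rotation_hardy_fun:
  assumes "cmod q = 1"
  shows "hardy_rotation q (hardy_fun c) = hardy_fun (\<lambda>n. q ^ n *\<^sub>C c n)"
  using assms
  by (auto simp: hardy_rotation_def hardy_fun_def norm_mult scaleC_scaleC power_mult_distrib
      mult.commute)


section \<open>Wold decomposition of a shift\<close>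

text \<open>For an isometry \<open>V\<close>, the orthogonal projection onto the image under
  \<open>V ^^ n\<close> of the kernel of \<open>cadjoint V\<close>.\<close>

definition wold_projection :: "('a::complex_hilbert_space \<Rightarrow> 'a) \<Rightarrow> nat \<Rightarrow> 'a \<Rightarrow> 'a" where
  "wold_projection V n x =
     (V ^^ n) ((cadjoint V ^^ n) x - V (cadjoint V ((cadjoint V ^^ n) x)))"

definition wold_rotation :: "('a::complex_hilbert_space \<Rightarrow> 'a) \<Rightarrow> complex \<Rightarrow> 'a \<Rightarrow> 'a" where
  "wold_rotation V q x = (\<Sum>n. q ^ n *\<^sub>C wold_projection V n x)"

lemma norm_sum_square_orthogonal:
  fixes f :: "'i \<Rightarrow> 'a::complex_hilbert_space"
  assumes "finite A" "\<And>i j. i \<noteq> j \<Longrightarrow> cinner (f i) (f j) = 0"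
  shows "(norm (sum f A))\<^sup>2 = (\<Sum>i\<in>A. (norm (f i))\<^sup>2)"
  using assms(1)
proof (induction A rule: finite_induct)
  case (insert i A)
  have "cinner (f i) (sum f A) = (\<Sum>j\<in>A. cinner (f i) (f j))"
    by (rule linear_sum[OF bounded_linear.linear[OF bounded_linear_cinner_right]])
  also have "\<dots> = 0"
    using insert.hyps by (intro sum.neutral) (auto intro: assms(2))
  finally show ?case
    using insert by (simp add: norm_add_square)
qed simp

text \<open>By Pythagoras, the Cauchy criterion for the squared norms is the one for
  \<open>f\<close>.\<close>

lemma summable_orthogonal:
  fixes f :: "nat \<Rightarrow> 'a::complex_hilbert_space"
  assumes "\<And>i j. i \<noteq> j \<Longrightarrow> cinner (f i) (f j) = 0" "summable (\<lambda>n. (norm (f n))\<^sup>2)"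
  shows "summable f"
  unfolding summable_Cauchy
proof (intro allI impI)
  fix e :: real
  assume e: "0 < e"
  then obtain N where N: "\<And>m n. m \<ge> N \<Longrightarrow> norm (\<Sum>k=m..<n. (norm (f k))\<^sup>2) < e\<^sup>2"
    using assms(2) unfolding summable_Cauchy by (metis zero_less_power)
  have "norm (sum f {m..<n}) < e" if "m \<ge> N" for m n
  proof (rule power2_less_imp_less)
    show "(norm (sum f {m..<n}))\<^sup>2 < e\<^sup>2"
      using N[OF that, of n] by (simp add: norm_sum_square_orthogonal[OF _ assms(1)])
  qed (use e in simp)
  then show "\<exists>N. \<forall>m\<ge>N. \<forall>n. norm (sum f {m..<n}) < e"
    by blast
qed

section \<open>Wold projections of a shift\<close>

locale wold_shift =
  fixes V :: "'a::complex_hilbert_space \<Rightarrow> 'a"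
  assumes shift: "shift_operator V"
begin

abbreviation E where "E \<equiv> wold_projection V"

lemma isometric: "isometric_operator V"
  and cadjoint_tendsto: "(\<lambda>n. (cadjoint V ^^ n) x) \<longlonglongrightarrow> 0"
  using shift by (auto simp: shift_operator_def)

lemma linear_V: "bounded_clinear V"
  using isometric by (simp add: isometric_operator_def)

lemma linear_E: "bounded_clinear (E n)"
proof -
  have adj: "bounded_clinear (cadjoint V)"
    by (rule bounded_clinear_cadjoint[OF linear_V])
  have "E n = (V ^^ n) \<circ> ((\<lambda>x. x - (V \<circ> cadjoint V) x) \<circ> (cadjoint V ^^ n))"
    by (auto simp: wold_projection_def)
  then show ?thesis
    using adj linear_V
    by (auto intro!: bounded_clinear_compose bounded_clinear_funpow bounded_clinear_diff
        bounded_clinear_id simp del: comp_apply)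
qed

lemma E_eq: "E n x = (V ^^ n) ((cadjoint V ^^ n) x) - (V ^^ Suc n) ((cadjoint V ^^ Suc n) x)"
  by (simp add: wold_projection_def bounded_clinearD[OF bounded_clinear_funpow[OF linear_V]]
      funpow_swap1)

text \<open>Only powers of the adjoint occur, which allows comparison with
  \<open>cinner_codefect\<close>.\<close>

lemma cinner_E:
  "cinner x (E n y) = cinner ((cadjoint V ^^ n) x) ((cadjoint V ^^ n) y)
     - cinner ((cadjoint V ^^ Suc n) x) ((cadjoint V ^^ Suc n) y)"
proof -
  have "cinner x ((V ^^ k) z) = cinner ((cadjoint V ^^ k) x) z" for k z
    by (metis cinner_cadjoint_funpow[OF linear_V] cinner_commute)
  then show ?thesis
    unfolding E_eq cinner_diff_right by metis
qed

lemma E_hermitian: "cinner (E n x) y = cinner x (E n y)"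
proof -
  have "cinner (E n x) y = cnj (cinner y (E n x))"
    by (rule cinner_commute)
  also have "\<dots> = cinner x (E n y)"
    unfolding cinner_E complex_cnj_diff by (metis cinner_commute)
  finally show ?thesis .
qed

lemma E_0_V: "E 0 (V x) = 0"
  by (simp add: wold_projection_def cadjoint_isometric_operator[OF isometric])

lemma E_Suc_V: "E (Suc n) (V x) = V (E n x)"
proof -
  have "(cadjoint V ^^ Suc n) (V x) = (cadjoint V ^^ n) x"
    by (simp only: funpow_Suc_right comp_apply cadjoint_isometric_operator[OF isometric])
  then show ?thesis
    by (simp add: wold_projection_def del: funpow.simps(2)) simp
qed

lemma E_funpow_V: "E (n + k) ((V ^^ k) x) = (V ^^ k) (E n x)"
  by (induction k) (simp_all add: E_Suc_V)

text \<open>For \<open>m < n\<close> the range of \<open>E n\<close> lies in that of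
  \<open>(V ^^ m) \<circ> V\<close>, and \<open>E m\<close> kills it: moving \<open>V ^^ m\<close>
  across leaves \<open>E 0\<close> applied to a value of \<open>V\<close>. Conjugate symmetry covers
  \<open>n < m\<close>.\<close>

lemma E_orthogonal:
  assumes "m \<noteq> n"
  shows "cinner (E m x) (E n y) = 0"
proof -
  have less: "cinner (E m x) (E n y) = 0" if "m < n" for m n x y
  proof -
    define z where "z = (cadjoint V ^^ n) y - V (cadjoint V ((cadjoint V ^^ n) y))"
    obtain k where k: "n = Suc k + m"
      using less_imp_Suc_add[OF \<open>m < n\<close>] by (auto simp: add.commute)
    have "E n y = (V ^^ m) (V ((V ^^ k) z))"
      unfolding wold_projection_def z_def[symmetric]
      by (simp only: k add.commute[of "Suc k"] funpow_add funpow.simps comp_apply)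
    then have "E m (E n y) = 0"
      using E_funpow_V[of 0 m] by (simp add: E_0_V bounded_clinearD(4)
          bounded_clinear_funpow[OF linear_V])
    then show ?thesis
      by (simp add: E_hermitian)
  qed
  show ?thesis
  proof (cases "m < n")
    case False
    with assms have "cinner (E n y) (E m x) = 0"
      by (intro less) simp
    then show ?thesis
      by (subst cinner_commute) simp
  qed (rule less)
qed

text \<open>The partial sums telescope, and the remainder has the norm of
  \<open>(cadjoint V ^^ N) x\<close>. Here the shift property enters, beyond isometry.\<close>

lemma E_sums: "(\<lambda>n. E n x) sums x"
proof -
  have "(\<Sum>n<N. E n x) = x - (V ^^ N) ((cadjoint V ^^ N) x)" for N
    unfolding E_eq by (subst sum_lessThan_telescope') simp
  moreover have "(\<lambda>N. (V ^^ N) ((cadjoint V ^^ N) x)) \<longlonglongrightarrow> 0"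
    using tendsto_norm[OF cadjoint_tendsto[of x]] isometric_operator_funpow[OF isometric]
    by (auto simp: isometric_operator_def intro: tendsto_norm_zero_cancel)
  ultimately show ?thesis
    unfolding sums_def using tendsto_diff[OF tendsto_const[of x]] by fastforce
qed

text \<open>Idempotence follows from completeness: in the expansion of \<open>E n x\<close> by
  \<open>E_sums\<close>, orthogonality leaves only the term \<open>m = n\<close>.\<close>

lemma E_E: "E m (E n x) = (if m = n then E n x else 0)"
proof -
  have off: "E m (E n x) = 0" if "m \<noteq> n" for m n
    by (rule cinner_ext_right) (simp add: E_orthogonal[OF that] flip: E_hermitian[of m])
  have "(\<lambda>m. E m (E n x)) sums E n x"
    by (rule E_sums)
  moreover have "(\<lambda>m. E m (E n x)) sums (\<Sum>m\<in>{n}. E m (E n x))"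
    by (rule sums_finite) (auto simp: off)
  ultimately have "E n (E n x) = E n x"
    using sums_unique2 by fastforce
  then show ?thesis
    by (simp add: off)
qed

text \<open>The terms are \<open>cinner (E n x) x\<close>, whose series converges by
  \<open>E_sums\<close> and continuity of the inner product.\<close>

lemma summable_norm_E: "summable (\<lambda>n. (norm (E n x))\<^sup>2)"
proof -
  have "complex_of_real ((norm (E n x))\<^sup>2) = cinner (E n x) x" for n
    by (simp add: E_hermitian E_E del: of_real_power flip: cinner_self)
  moreover have "summable (\<lambda>n. cinner (E n x) x)"
    using bounded_linear.sums[OF bounded_linear_cinner_left E_sums] sums_summable by blast
  ultimately have "summable (\<lambda>n. complex_of_real ((norm (E n x))\<^sup>2))"
    by simp
  then show ?thesis
    by (simp only: summable_of_real_iff)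
qed

section \<open>Rotation along the Wold decomposition\<close>

lemma wold_rotation_sums:
  assumes "cmod q = 1"
  shows "(\<lambda>n. q ^ n *\<^sub>C E n x) sums wold_rotation V q x"
  unfolding wold_rotation_def
proof (intro summable_sums summable_orthogonal)
  show "cinner (q ^ i *\<^sub>C E i x) (q ^ j *\<^sub>C E j x) = 0" if "i \<noteq> j" for i j
    by (simp add: cinner_scaleC_left cinner_scaleC_right E_orthogonal[OF that])
  show "summable (\<lambda>n. (norm (q ^ n *\<^sub>C E n x))\<^sup>2)"
    by (simp add: norm_scaleC norm_power assms summable_norm_E)
qed

lemma wold_rotation_V:
  assumes q: "cmod q = 1"
  shows "wold_rotation V q (V x) = q *\<^sub>C V (wold_rotation V q x)"
proof -
  have "(\<lambda>n. V (q ^ n *\<^sub>C E n x)) sums V (wold_rotation V q x)"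
    by (rule bounded_linear.sums[OF bounded_clinearD(1)[OF linear_V] wold_rotation_sums[OF q]])
  from bounded_linear.sums[OF bounded_linear_scaleC this, of q]
  have "(\<lambda>n. q ^ Suc n *\<^sub>C E (Suc n) (V x)) sums (q *\<^sub>C V (wold_rotation V q x))"
    by (simp add: E_Suc_V bounded_clinearD(5)[OF linear_V] scaleC_scaleC)
  \<comment> \<open>The index shift adds no term, because \<open>E 0 (V x) = 0\<close>.\<close>
  then have "(\<lambda>n. q ^ n *\<^sub>C E n (V x)) sums (q *\<^sub>C V (wold_rotation V q x))"
    by (subst (asm) sums_Suc_iff) (simp add: E_0_V)
  with wold_rotation_sums[OF q] show ?thesis
    by (rule sums_unique2)
qed

text \<open>The rotation acts on the component \<open>E m x\<close> as the scalar
  \<open>q ^ m\<close>, which \<open>cnj q ^ m\<close> cancels; \<open>E_sums\<close> then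
  reassembles \<open>x\<close>.\<close>

lemma wold_rotation_cnj:
  assumes q: "cmod q = 1"
  shows "wold_rotation V (cnj q) (wold_rotation V q x) = x"
proof -
  have unit: "cnj q ^ m * q ^ m = 1" for m
    using complex_norm_square[of q] q by (simp add: mult.commute flip: power_mult_distrib)
  have "E m (wold_rotation V q x) = q ^ m *\<^sub>C E m x" for m
  proof -
    have "(\<lambda>n. E m (q ^ n *\<^sub>C E n x)) sums E m (wold_rotation V q x)"
      by (rule bounded_linear.sums[OF bounded_clinearD(1)[OF linear_E] wold_rotation_sums[OF q]])
    moreover have "(\<lambda>n. E m (q ^ n *\<^sub>C E n x)) sums (\<Sum>n\<in>{m}. E m (q ^ n *\<^sub>C E n x))"
      by (rule sums_finite) (auto simp: bounded_clinearD(5)[OF linear_E] E_E)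
    ultimately show ?thesis
      using sums_unique2 by (fastforce simp: bounded_clinearD(5)[OF linear_E] E_E)
  qed
  then have "(\<lambda>n. E n x) sums wold_rotation V (cnj q) (wold_rotation V q x)"
    using wold_rotation_sums[of "cnj q" "wold_rotation V q x"] q
    by (simp add: scaleC_scaleC unit)
  then show ?thesis
    using E_sums sums_unique2 by blast
qed

lemma wold_rotation_scaleC:
  assumes q: "cmod q = 1"
  shows "wold_rotation V q (c *\<^sub>C x) = c *\<^sub>C wold_rotation V q x"
proof (rule sums_unique2[OF wold_rotation_sums[OF q]])
  show "(\<lambda>n. q ^ n *\<^sub>C E n (c *\<^sub>C x)) sums (c *\<^sub>C wold_rotation V q x)"
    using bounded_linear.sums[OF bounded_linear_scaleC wold_rotation_sums[OF q], of c x]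
    by (simp add: bounded_clinearD(5)[OF linear_E] scaleC_scaleC mult.commute)
qed

end


section \<open>The rotation associated with a pair of isometries\<close>

lemma bcl_rotation_eq_wold_rotation:
  fixes V1 V2 :: "'a::complex_hilbert_space \<Rightarrow> 'a"
  assumes q: "cmod q = 1"
    and V1: "isometric_operator V1" and V2: "isometric_operator V2"
    and V: "shift_operator (V1 \<circ> V2)"
  shows "bcl_rotation V1 V2 q = wold_rotation (V1 \<circ> V2) q"
proof
  fix h
  interpret wold_shift "V1 \<circ> V2"
    by (rule wold_shift.intro[OF V])
  define W where "W = cadjoint (V1 \<circ> V2)"
  define c where "c h n = (codefect V1 ((W ^^ n) h), codefect V2 (cadjoint V1 ((W ^^ n) h)))"
    for h n
  have lin: "bounded_clinear V1" "bounded_clinear V2"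
    using V1 V2 by (auto simp: isometric_operator_def)
  have W: "W x = cadjoint V2 (cadjoint V1 x)" for x
    by (simp add: W_def cadjoint_comp[OF lin])
  \<comment> \<open>The term with \<open>cadjoint V1\<close> subtracted by the first codefect is
    restored by the second; what remains is the difference in \<open>cinner_E\<close>.\<close>
  have cinner_c: "cinner (c x n) (c y n) = cinner x (E n y)" for x y n
    unfolding cinner_E
    by (simp add: c_def cinner_prod_def cinner_codefect[OF V1] cinner_codefect[OF V2] W
        flip: W_def)
  have norm_c: "(norm (c x n))\<^sup>2 = (norm (E n x))\<^sup>2" for x n
  proof -
    have "cinner (c x n) (c x n) = cinner (E n x) (E n x)"
      by (simp add: cinner_c E_hermitian E_E)
    then show ?thesis
      unfolding cinner_self by (simp only: of_real_eq_iff)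
  qed
  define d where "d n = q ^ n *\<^sub>C c h n" for n
  have sum_c: "summable (\<lambda>n. (norm (c x n))\<^sup>2)" for x
    by (simp only: norm_c summable_norm_E)
  have sum_d: "summable (\<lambda>n. (norm (d n))\<^sup>2)"
    using sum_c[of h] by (simp add: d_def norm_scaleC norm_power q)
  have transform: "bcl_transform V1 V2 x = hardy_fun (c x)" for x
    by (simp add: bcl_transform_def c_def[abs_def] W_def)
  \<comment> \<open>\<open>hardy_adjoint\<close> is specified only on \<open>hardy_space\<close>, so
    membership must be shown. Scalars move inside the codefects, which keeps the rotated
    coefficients in their ranges.\<close>
  have "d n \<in> bcl_space V1 V2" for n
    using closure_subset[of "range (codefect _)"]
    by (auto simp: d_def c_def bcl_space_def codefect_space_def scaleC_prod_def
        codefect_scaleC[OF V1, symmetric] codefect_scaleC[OF V2, symmetric])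
  then have mem: "hardy_fun d \<in> hardy_space (bcl_space V1 V2)"
    using sum_d by (auto simp: hardy_space_def)
  \<comment> \<open>This is the property that defines the adjoint, with the Wold rotation of
    \<open>h\<close> as the representing vector.\<close>
  have inner: "hardy_inner (bcl_transform V1 V2 x) (hardy_fun d)
      = cinner x (wold_rotation (V1 \<circ> V2) q h)" for x
  proof -
    have "(\<lambda>n. cinner x (q ^ n *\<^sub>C E n h)) sums cinner x (wold_rotation (V1 \<circ> V2) q h)"
      by (rule bounded_linear.sums[OF bounded_linear_cinner_right wold_rotation_sums[OF q]])
    moreover have "cinner (c x n) (d n) = cinner x (q ^ n *\<^sub>C E n h)" for n
      by (simp add: d_def cinner_scaleC_right cinner_c)
    ultimately show ?thesis
      by (simp add: hardy_inner_def transform hardy_coeff_hardy_fun sum_c sum_d sums_iff)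
  qed
  have "bcl_rotation V1 V2 q h
      = hardy_adjoint (bcl_space V1 V2) (bcl_transform V1 V2) (hardy_fun d)"
    by (simp add: bcl_rotation_def transform hardy_rotation_hardy_fun[OF q] d_def[abs_def])
  also have "\<dots> = (THE g. \<forall>x. hardy_inner (bcl_transform V1 V2 x) (hardy_fun d) = cinner x g)"
    by (simp add: hardy_adjoint_def mem)
  also have "\<dots> = wold_rotation (V1 \<circ> V2) q h"
    unfolding inner by (rule the_equality) (auto intro: cinner_ext_right)
  finally show "bcl_rotation V1 V2 q h = wold_rotation (V1 \<circ> V2) q h" .
qed

section \<open>Both equivalences from the algebra of two mutually inverse rotations\<close>

theorem theorem2p6:
  fixes q :: complex and V1 V2 :: "'a::complex_hilbert_space \<Rightarrow> 'a"
  assumes "cmod q = 1"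
    and "isometric_operator V1"
    and "isometric_operator V2"
    and "shift_operator (V1 \<circ> V2)"
  shows
    "(commutative_pair V1 V2 \<longleftrightarrow>
        q_commutative_pair q (V1 \<circ> bcl_rotation V1 V2 q) (bcl_rotation V1 V2 (cnj q) \<circ> V2)) \<and>
     (q_commutative_pair q V1 V2 \<longleftrightarrow>
        commutative_pair (V1 \<circ> bcl_rotation V1 V2 (cnj q)) (bcl_rotation V1 V2 q \<circ> V2))"
proof -
  interpret wold_shift "V1 \<circ> V2"
    by (rule wold_shift.intro) fact
  define r where "r = bcl_rotation V1 V2 q"
  define s where "s = bcl_rotation V1 V2 (cnj q)"
  have q': "cmod (cnj q) = 1"
    using assms(1) by simp
  have r: "r = wold_rotation (V1 \<circ> V2) q" and s: "s = wold_rotation (V1 \<circ> V2) (cnj q)"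
    unfolding r_def s_def using assms q' by (simp_all add: bcl_rotation_eq_wold_rotation)
  have sr: "s (r x) = x" and rs: "r (s x) = x" for x
    using wold_rotation_cnj[OF assms(1)] wold_rotation_cnj[OF q'] by (simp_all add: r s)
  have rV: "r (V1 (V2 x)) = q *\<^sub>C V1 (V2 (r x))"
    and sV: "s (V1 (V2 x)) = cnj q *\<^sub>C V1 (V2 (s x))" for x
    using wold_rotation_V[OF assms(1)] wold_rotation_V[OF q'] by (simp_all add: r s)
  have r_scaleC: "r (c *\<^sub>C x) = c *\<^sub>C r x" for c x
    using wold_rotation_scaleC[OF assms(1)] by (simp add: r)
  have qq: "q * cnj q = 1" "cnj q * q = 1"
    using complex_norm_square[of q] assms(1) by (simp_all add: mult.commute)
  have "commutative_pair V1 V2 \<longleftrightarrow> (\<forall>x. q *\<^sub>C s (V2 (V1 (r x))) = V1 (V2 x))"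
  proof -
    \<comment> \<open>Used with \<open>y = V2 (V1 (r x))\<close>; surjectivity of \<open>r\<close>
      then turns the identity at \<open>r x\<close> into one at every vector.\<close>
    have "q *\<^sub>C s y = V1 (V2 x) \<longleftrightarrow> y = V1 (V2 (r x))" for x y
    proof -
      have "q *\<^sub>C s (V1 (V2 (r x))) = V1 (V2 x)"
        by (simp add: sV sr scaleC_scaleC qq)
      moreover have "r (cnj q *\<^sub>C q *\<^sub>C s z) = z" for z
        by (simp add: scaleC_scaleC qq rs)
      ultimately show ?thesis
        by metis
    qed
    then show ?thesis
      unfolding commutative_pair_def fun_eq_iff comp_apply by (metis rs)
  qed
  moreover have "q_commutative_pair q V1 V2 \<longleftrightarrow> (\<forall>x. r (V2 (V1 (s x))) = V1 (V2 x))"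
  proof -
    \<comment> \<open>The analogue with \<open>y = V2 (V1 (s x))\<close> and surjectivity of
      \<open>s\<close>.\<close>
    have "r y = V1 (V2 x) \<longleftrightarrow> q *\<^sub>C y = V1 (V2 (s x))" for x y
    proof -
      have "r (cnj q *\<^sub>C V1 (V2 (s x))) = V1 (V2 x)"
        by (simp add: r_scaleC rV rs scaleC_scaleC qq)
      moreover have "q *\<^sub>C cnj q *\<^sub>C z = z" "cnj q *\<^sub>C q *\<^sub>C z = z" for z :: 'a
        by (simp_all add: scaleC_scaleC qq)
      ultimately show ?thesis
        by (metis sr)
    qed
    then show ?thesis
      unfolding q_commutative_pair_def fun_eq_iff comp_apply by (metis sr)
  qed
  ultimately show ?thesis
    unfolding r_def[symmetric] s_def[symmetric]
    \<comment> \<open>In each modified pair the inner rotations cancel, so one of the two products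
      is just \<open>V1 (V2 x)\<close>.\<close>
    by (auto simp: commutative_pair_def q_commutative_pair_def fun_eq_iff rs sr)
qed

end
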